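(* Let $k\ge1$ and let $p_1\ge p_2\ge\dots\ge p_k>0$ with $\sum_{j=1}^k p_j=1$. Let $h:2^{[k]}\to\mathbb{R}$ be the (unique) solution of the linear system $$h(\emptyset)=0,\qquad p_m\big(h(S)-h(S\setminus\{m\})\big)=1+\sum_{j\notin S}p_j\big(h(S\cup\{j\})-h(S)\big)\quad\text{for all }\emptyset\ne S\subseteq[k],\ m=\min(S).$$ Then $h(\{k\})\ge \alpha_k/p_k$, where $\alpha_1=1$ and $\alpha_\ell=1+(\ell-1)\alpha_{\ell-1}$ for $\ell>1$.
   Context: The system describes the expected hitting time of $\emptyset$ in a Markov chain on subsets of $[k]$: from $S\ne\emptyset$ with $m=\min S$, go to $S\setminus\{m\}$ with probability $p_m$, to $S\cup\{j\}$ with probability $p_j$ for each $j\notin S$, and stay at $S$ otherwise; $h(S)$ is the expected number of steps to reach $\emptyset$ from $S$. *)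

theory Defs
  imports Complex_Main "HOL-Library.FuncSet"
begin

definition solves_system :: "nat \<Rightarrow> (nat \<Rightarrow> real) \<Rightarrow> (nat set \<Rightarrow> real) \<Rightarrow> bool" where
  "solves_system k p h \<longleftrightarrow>
     h {} = 0 \<and>
     (\<forall>S. S \<subseteq> {1..k} \<and> S \<noteq> {} \<longrightarrow>
        p (Min S) * (h S - h (S - {Min S})) =
          1 + (\<Sum>j\<in>{1..k} - S. p j * (h (insert j S) - h S)))"

(* The value at 0 is junk. *)
fun alpha :: "nat \<Rightarrow> real" where
  "alpha 0 = 0"
| "alpha (Suc 0) = 1"
| "alpha (Suc (Suc n)) = 1 + real (Suc n) * alpha (Suc n)"

end

(* Work with an arbitrary finite set A of indices, as the induction removes an element from it.
   The system says that L h = 1 off the empty set, where L is a Z-matrix. Looking at a minimiser of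
   least cardinality gives the minimum principle: L w >= 0 and w {} >= 0 force w >= 0. It yields
   uniqueness, and a monotone iteration below an explicit supersolution yields existence.

   Put D_i(S) = h(S) - h(S - {i}) for i in S. Subtracting the equations at S and S - {i} gives
   recursions for D_i, and looking at the global minimum of D_i(S), and then at that of
   p_i D_i(S) - p_j D_j(S) over j <= i, shows that both are nonnegative when p is antitone.

   Hence for fixed j the function u(T) = h({j} + T) - h({j}) on subsets of A - {j} is a supersolution
   of the system for A - {j}: at {j} + T the equation removes the minimum, and replacing it by
   Min T only increases p_i D_i. So u dominates the solution g of the smaller system. By induction on
   card A, p_l g({l}) >= alpha (card A - 1) for every l in A - {j}, and the equation at {j} turns
   this into p_j h({j}) >= 1 + (card A - 1) alpha (card A - 1). *)

theory Submission
  imports Defs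
begin

section \<open>The operator, its minimum principle and uniqueness\<close>

locale weighted_chain =
  fixes A :: "nat set" and p :: "nat \<Rightarrow> real"
  assumes fin: "finite A"
    and pos: "j \<in> A \<Longrightarrow> p j > 0"
begin

text \<open>The operator L, minus the generator of the chain. Only nonempty \<open>S\<close> matter,
  \<open>Min {}\<close> being arbitrary.\<close>

definition gen :: "(nat set \<Rightarrow> real) \<Rightarrow> nat set \<Rightarrow> real" where
  "gen h S = p (Min S) * (h S - h (S - {Min S})) - (\<Sum>j\<in>A - S. p j * (h (insert j S) - h S))"

definition solution :: "(nat set \<Rightarrow> real) \<Rightarrow> bool" where
  "solution h \<longleftrightarrow> h {} = 0 \<and> (\<forall>S. S \<subseteq> A \<and> S \<noteq> {} \<longrightarrow> gen h S = 1)"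

lemma gen_diff: "gen (\<lambda>S. f S - g S) S = gen f S - gen g S"
  by (simp add: gen_def algebra_simps sum_subtractf sum.distrib)

lemma Min_mem: "S \<subseteq> A \<Longrightarrow> S \<noteq> {} \<Longrightarrow> Min S \<in> S"
  using fin by (meson Min_in finite_subset)

lemma pos_Min: "S \<subseteq> A \<Longrightarrow> S \<noteq> {} \<Longrightarrow> p (Min S) > 0"
  using Min_mem pos by blast

lemma sum_nonneg_compl: "(\<Sum>l\<in>A - S. p l) \<ge> 0"
  by (intro sum_nonneg) (use pos in \<open>auto intro: less_imp_le\<close>)

text \<open>At a minimiser additions cannot lower \<open>w\<close>. If the minimum is negative and
  the cardinality least, removing \<open>Min T\<close> strictly raises \<open>w\<close>, so
  \<open>gen w T < 0\<close>.\<close>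

lemma minimum_principle:
  assumes "w {} \<ge> 0" and gen: "\<And>S. S \<subseteq> A \<Longrightarrow> S \<noteq> {} \<Longrightarrow> gen w S \<ge> 0" and "S \<subseteq> A"
  shows "w S \<ge> 0"
proof (rule ccontr)
  assume neg: "\<not> w S \<ge> 0"
  define \<mu> where "\<mu> = Min (w ` Pow A)"
  have fin': "finite (w ` Pow A)" using fin by simp
  have le: "\<mu> \<le> w T" if "T \<subseteq> A" for T
    unfolding \<mu>_def using that fin' by (intro Min_le) auto
  have "\<mu> \<in> w ` Pow A" unfolding \<mu>_def using fin' by (intro Min_in) auto
  then obtain T0 where T0: "T0 \<subseteq> A \<and> w T0 = \<mu>" by auto
  \<comment> \<open>among the minimisers, one of least cardinality has a strictly larger value below it\<close>
  obtain T where T: "T \<subseteq> A" "w T = \<mu>"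
    and least: "\<And>T'. T' \<subseteq> A \<Longrightarrow> w T' = \<mu> \<Longrightarrow> card T \<le> card T'"
    using ex_has_least_nat[of "\<lambda>T. T \<subseteq> A \<and> w T = \<mu>" T0 card, OF T0] by blast
  have "\<mu> < 0" using le[OF assms(3)] neg by simp
  with T assms(1) have ne: "T \<noteq> {}" by auto
  let ?m = "Min T"
  have m: "?m \<in> T" using Min_mem T ne by blast
  have finT: "finite T" using T fin finite_subset by blast
  have sub: "T - {?m} \<subseteq> A" using T by blast
  have "card (T - {?m}) < card T" using m finT by (meson card_Diff1_less)
  hence "w (T - {?m}) \<noteq> \<mu>" using least[OF sub] by linarith
  hence "w (T - {?m}) > w T" using le[OF sub] T by simp
  hence "p ?m * (w T - w (T - {?m})) < 0"
    using pos_Min[OF T(1) ne] by (simp add: mult_less_0_iff)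
  moreover have "(\<Sum>j\<in>A - T. p j * (w (insert j T) - w T)) \<ge> 0"
    using T le by (intro sum_nonneg mult_nonneg_nonneg) (auto simp: less_imp_le pos)
  ultimately show False using gen[OF T(1) ne] by (simp add: gen_def)
qed

lemma comparison:
  assumes "solution g" "u {} \<ge> 0"
    "\<And>S. S \<subseteq> A \<Longrightarrow> S \<noteq> {} \<Longrightarrow> gen u S \<ge> 1" "S \<subseteq> A"
  shows "g S \<le> u S"
  using minimum_principle[of "\<lambda>S. u S - g S" S] assms by (simp add: gen_diff solution_def)

lemma solution_unique:
  assumes "solution g" "solution h" "S \<subseteq> A"
  shows "g S = h S"
  using comparison[of g h S] comparison[of h g S] assms
  by (intro antisym) (auto simp: solution_def)

section \<open>Existence of a solution\<close>

lemma supersolution_exists: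
  obtains u where "u {} = 0" "\<And>S. S \<subseteq> A \<Longrightarrow> u S \<ge> 0"
    "\<And>S. S \<subseteq> A \<Longrightarrow> S \<noteq> {} \<Longrightarrow> gen u S \<ge> 1"
proof (cases "A = {}")
  case True
  then show ?thesis using that[of "\<lambda>_. 0"] by simp
next
  case False
  define q where "q = Min (p ` A)"
  define P where "P = sum p A"
  have q: "q \<le> p j" if "j \<in> A" for j
    unfolding q_def using that fin by simp
  have "q \<in> p ` A" unfolding q_def using fin False by (intro Min_in) auto
  hence q0: "q > 0" using pos by auto
  have P0: "P \<ge> 0" unfolding P_def using pos by (intro sum_nonneg) (auto intro: less_imp_le)
  \<comment> \<open>For \<open>u S = K * (1 - r ^ card S)\<close> each added element gains only \<open>r\<close> times what removing one
    loses; \<open>P * r \<le> q / 2\<close> makes the loss win, and \<open>K\<close> scales the difference to at least 1.\<close>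
  define r where "r = q / (2 * (P + q))"
  have r0: "r > 0" unfolding r_def using q0 P0 by simp
  have r1: "r < 1" unfolding r_def using q0 P0 by (simp add: field_simps)
  have Pr: "P * r \<le> q / 2" unfolding r_def using q0 P0 by (simp add: field_simps)
  define K where "K = 2 / (q * (1 - r) * r ^ card A)"
  have K0: "K > 0" unfolding K_def using q0 r0 r1 by simp
  define u where "u S = K * (1 - r ^ card S)" for S :: "nat set"
  have "gen u S \<ge> 1" if S: "S \<subseteq> A" "S \<noteq> {}" for S
  proof -
    have finS: "finite S" using S fin finite_subset by blast
    let ?m = "Min S"
    have m: "?m \<in> S" using Min_mem S by blast
    obtain n where n: "card S = Suc n"
      using finS S by (cases "card S") auto
    have n': "card (S - {?m}) = n" using n m finS by simp
    have nA: "n \<le> card A" using n S fin by (metis Suc_leD card_mono)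
    \<comment> \<open>\<open>d\<close> is the increment of \<open>u\<close> from cardinality
      \<open>n\<close> to \<open>Suc n\<close>, and \<open>r * d\<close> is the next one. Hence
      \<open>gen u S\<close> is at least \<open>(q - P * r) * d\<close>, which is at least
      \<open>q / 2 * d\<close>.\<close>
    define d where "d = K * (1 - r) * r ^ n"
    have d0: "d > 0" unfolding d_def using K0 r0 r1 by simp
    have "r ^ card A \<le> r ^ n" using nA r0 r1 by (simp add: power_decreasing)
    hence "K * (1 - r) * r ^ card A \<le> d"
      unfolding d_def using K0 r1 by (intro mult_left_mono) auto
    moreover have "K * (1 - r) * r ^ card A = 2 / q"
      unfolding K_def using r0 r1 q0 by (simp add: field_simps)
    ultimately have dq: "q / 2 * d \<ge> 1" using q0 by (simp add: pos_divide_le_eq mult.commute)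
    have "u S - u (S - {?m}) = d"
      unfolding u_def d_def n n' by (simp add: algebra_simps)
    hence "p ?m * (u S - u (S - {?m})) \<ge> q * d"
      using q[of ?m] m S d0 by auto
    moreover have "(\<Sum>j\<in>A - S. p j * (u (insert j S) - u S)) = (\<Sum>j\<in>A - S. p j * (r * d))"
      using finS n by (intro sum.cong) (auto simp: u_def d_def algebra_simps)
    moreover have "\<dots> = (\<Sum>j\<in>A - S. p j) * (r * d)" by (simp add: sum_distrib_right)
    moreover have "(\<Sum>j\<in>A - S. p j) \<le> P"
      unfolding P_def using fin pos by (intro sum_mono2) (auto intro: less_imp_le)
    hence "(\<Sum>j\<in>A - S. p j) * (r * d) \<le> P * (r * d)"
      using r0 d0 by (intro mult_right_mono) auto
    moreover have "P * (r * d) \<le> q / 2 * d" using Pr d0 by (simp add: mult.assoc[symmetric])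
    ultimately show ?thesis unfolding gen_def using dq by (simp add: field_simps)
  qed
  moreover have "u S \<ge> 0" for S
    unfolding u_def using K0 r0 r1 by (simp add: power_le_one)
  moreover have "u {} = 0" by (simp add: u_def)
  ultimately show ?thesis using that by blast
qed

lemma gen_alt:
  "gen h S = h S * (p (Min S) + sum p (A - S))
     - (p (Min S) * h (S - {Min S}) + (\<Sum>j\<in>A - S. p j * h (insert j S)))"
  by (simp add: gen_def algebra_simps sum_subtractf sum_distrib_left sum_distrib_right)

text \<open>Jacobi iteration: the equation at \<open>S\<close> solved for its diagonal unknown, with
  all other values taken from \<open>v\<close>. The value 0 at \<open>{}\<close> encodes the
  boundary condition.\<close>

definition jacobi :: "(nat set \<Rightarrow> real) \<Rightarrow> nat set \<Rightarrow> real" where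
  "jacobi v S = (if S = {} then 0 else
     (1 + p (Min S) * v (S - {Min S}) + (\<Sum>j\<in>A - S. p j * v (insert j S)))
       / (p (Min S) + sum p (A - S)))"

lemma jacobi_denom_pos: "S \<subseteq> A \<Longrightarrow> S \<noteq> {} \<Longrightarrow> p (Min S) + sum p (A - S) > 0"
  using pos_Min[of S] sum_nonneg_compl[of S] by linarith

lemma jacobi_mono:
  assumes "\<And>S. S \<subseteq> A \<Longrightarrow> v S \<le> w S" "S \<subseteq> A"
  shows "jacobi v S \<le> jacobi w S"
proof (cases "S = {}")
  case False
  have "(\<Sum>j\<in>A - S. p j * v (insert j S)) \<le> (\<Sum>j\<in>A - S. p j * w (insert j S))"
    using assms pos by (intro sum_mono mult_left_mono) (auto intro: less_imp_le)
  moreover have "p (Min S) * v (S - {Min S}) \<le> p (Min S) * w (S - {Min S})"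
    using assms(2) pos_Min[OF assms(2) False] by (intro mult_left_mono assms(1)) auto
  ultimately show ?thesis
    using False jacobi_denom_pos[OF assms(2) False]
    by (auto simp: jacobi_def intro!: divide_right_mono)
qed (simp add: jacobi_def)

lemma jacobi_le_iff: "S \<subseteq> A \<Longrightarrow> S \<noteq> {} \<Longrightarrow> jacobi v S \<le> v S \<longleftrightarrow> gen v S \<ge> 1"
  using jacobi_denom_pos[of S] by (auto simp: jacobi_def gen_alt pos_divide_le_eq)

lemma jacobi_eq_iff: "S \<subseteq> A \<Longrightarrow> S \<noteq> {} \<Longrightarrow> jacobi v S = v S \<longleftrightarrow> gen v S = 1"
  using jacobi_denom_pos[of S] by (auto simp: jacobi_def gen_alt divide_eq_eq)

text \<open>Starting from 0, the first iterate is nonnegative, so by monotonicity of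
  \<open>jacobi\<close> the iterates increase; they stay below the supersolution. Their pointwise
  limit is a fixed point because \<open>jacobi\<close> involves only finite sums.\<close>

lemma solution_exists: "\<exists>h. solution h"
proof -
  obtain u where u: "u {} = 0" "\<And>S. S \<subseteq> A \<Longrightarrow> u S \<ge> 0"
    "\<And>S. S \<subseteq> A \<Longrightarrow> S \<noteq> {} \<Longrightarrow> gen u S \<ge> 1"
    using supersolution_exists by blast
  have super: "jacobi u S \<le> u S" if "S \<subseteq> A" for S
    using that u jacobi_le_iff[of S u] by (cases "S = {}") (auto simp: jacobi_def)
  define V where "V n = (jacobi ^^ n) (\<lambda>_. 0)" for n
  have V0: "V 0 S = 0" and VS: "V (Suc n) S = jacobi (V n) S" for n S
    by (simp_all add: V_def)
  have up: "V n S \<le> u S" if "S \<subseteq> A" for n S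
    using that
  proof (induction n arbitrary: S)
    case (Suc n)
    then show ?case using jacobi_mono[of "V n" u S] super[of S] by (force simp: VS)
  qed (simp add: V0 u)
  have mono: "V n S \<le> V (Suc n) S" if "S \<subseteq> A" for n S
    using that
  proof (induction n arbitrary: S)
    case 0
    have "sum p (A - S) \<ge> 0" by (rule sum_nonneg_compl)
    then show ?case using 0 jacobi_denom_pos[of S] by (auto simp: VS V0 jacobi_def less_imp_le)
  next
    case (Suc n)
    then show ?case using jacobi_mono[of "V n" "V (Suc n)" S] by (simp add: VS)
  qed
  define h where "h S = lim (\<lambda>n. V n S)" for S
  have lim: "(\<lambda>n. V n S) \<longlonglongrightarrow> h S" if "S \<subseteq> A" for S
  proof -
    have "incseq (\<lambda>n. V n S)" using mono[OF that] by (rule incseq_SucI)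
    moreover have "\<forall>n. V n S \<le> u S" using up that by blast
    ultimately obtain L where "(\<lambda>n. V n S) \<longlonglongrightarrow> L"
      by (rule incseq_convergent)
    thus ?thesis unfolding h_def by (metis limI)
  qed
  have fixpoint: "jacobi h S = h S" if S: "S \<subseteq> A" for S
  proof -
    have "(\<lambda>n. jacobi (V n) S) \<longlonglongrightarrow> jacobi h S"
    proof (cases "S = {}")
      case False
      have "p (Min S) + sum p (A - S) \<noteq> 0" using jacobi_denom_pos[OF S False] by simp
      then show ?thesis using S False unfolding jacobi_def
        by (auto intro!: tendsto_intros lim)
    qed (simp add: jacobi_def)
    moreover have "(\<lambda>n. jacobi (V n) S) \<longlonglongrightarrow> h S"
      using LIMSEQ_Suc[OF lim[OF S]] by (simp add: VS)
    ultimately show ?thesis by (rule LIMSEQ_unique)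
  qed
  moreover have "h {} = 0" using fixpoint[of "{}"] by (simp add: jacobi_def)
  ultimately have "solution h" by (auto simp: solution_def simp flip: jacobi_eq_iff)
  thus ?thesis by blast
qed

lemma solution_nonneg:
  assumes "solution h" "S \<subseteq> A"
  shows "h S \<ge> 0"
  using minimum_principle[of h S] assms by (simp add: solution_def)

end

section \<open>Increments of the solution for antitone weights\<close>

locale sorted_chain = weighted_chain +
  assumes sorted: "i \<in> A \<Longrightarrow> j \<in> A \<Longrightarrow> i \<le> j \<Longrightarrow> p j \<le> p i"
begin

context
  fixes h assumes h: "solution h"
begin

text \<open>The increment D_i(S), intended for \<open>i \<in> S\<close>; otherwise it is 0.\<close>

definition marginal :: "nat \<Rightarrow> nat set \<Rightarrow> real" where
  "marginal i S = h S - h (S - {i})"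

lemma gen_h: "S \<subseteq> A \<Longrightarrow> S \<noteq> {} \<Longrightarrow>
    p (Min S) * marginal (Min S) S - (\<Sum>l\<in>A - S. p l * (h (insert l S) - h S)) = 1"
  using h by (auto simp: solution_def gen_def marginal_def)

lemma sum_marginal:
  assumes "i \<in> S"
  shows "(\<Sum>l\<in>A - S. p l * marginal i (insert l S)) =
    (\<Sum>l\<in>A - S. p l * (h (insert l S) - h S))
    - (\<Sum>l\<in>A - S. p l * (h (insert l (S - {i})) - h (S - {i})))
    + sum p (A - S) * marginal i S"
proof -
  have "marginal i (insert l S) = h (insert l S) - h (insert l (S - {i}))" if "l \<in> A - S" for l
  proof -
    have "insert l S - {i} = insert l (S - {i})" using that assms by auto
    thus ?thesis by (simp add: marginal_def)
  qed
  hence "(\<Sum>l\<in>A - S. p l * marginal i (insert l S)) =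
    (\<Sum>l\<in>A - S. p l * (h (insert l S) - h (insert l (S - {i}))))"
    by (intro sum.cong) auto
  thus ?thesis
    by (simp add: marginal_def right_diff_distrib sum_subtractf sum_distrib_right)
qed

text \<open>At \<open>S - {i}\<close> the index \<open>i\<close> is one more possible addition, and
  it leads back to \<open>S\<close>.\<close>

lemma sum_compl_remove:
  assumes "S \<subseteq> A" "i \<in> S"
  shows "(\<Sum>l\<in>A - (S - {i}). p l * (h (insert l (S - {i})) - h (S - {i}))) =
    p i * marginal i S + (\<Sum>l\<in>A - S. p l * (h (insert l (S - {i})) - h (S - {i})))"
proof -
  have "A - (S - {i}) = insert i (A - S)" "insert i S = S" using assms by auto
  thus ?thesis using assms fin by (simp add: marginal_def)
qed

text \<open>Subtract the equation at \<open>S - {i}\<close> from that at \<open>S\<close>; both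
  remove the same minimum. The coefficient on the left exceeds the total weight on the right by
  \<open>p i\<close>.\<close>

lemma marginal_rec:
  assumes S: "S \<subseteq> A" "i \<in> S" "i \<noteq> Min S"
  shows "(p (Min S) + p i + sum p (A - S)) * marginal i S =
    p (Min S) * marginal i (S - {Min S}) + (\<Sum>l\<in>A - S. p l * marginal i (insert l S))"
proof -
  let ?m = "Min S"
  have ne: "S \<noteq> {}" using S by auto
  have finS: "finite S" using S fin finite_subset by blast
  have m: "?m \<in> S" using Min_mem S ne by blast
  have Min': "Min (S - {i}) = ?m"
    using finS m S by (intro Min_eqI) auto
  have "S - {i} \<subseteq> A" "S - {i} \<noteq> {}" using S m by auto
  from gen_h[OF this] have 1: "p ?m * marginal ?m (S - {i}) - p i * marginal i S
      - (\<Sum>l\<in>A - S. p l * (h (insert l (S - {i})) - h (S - {i}))) = 1"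
    using S by (simp add: Min' sum_compl_remove)
  \<comment> \<open>The mixed second difference of \<open>h\<close> is symmetric in \<open>i\<close>
    and \<open>?m\<close>.\<close>
  have 2: "marginal ?m S - marginal ?m (S - {i}) = marginal i S - marginal i (S - {?m})"
  proof -
    have "S - {i} - {?m} = S - {?m} - {i}" by blast
    thus ?thesis by (simp add: marginal_def)
  qed
  have "p ?m * (marginal ?m S - marginal ?m (S - {i}))
      = p ?m * (marginal i S - marginal i (S - {?m}))" by (simp add: 2)
  with 1 gen_h[OF S(1) ne] sum_marginal[OF S(2)] show ?thesis
    by (simp add: algebra_simps)
qed

text \<open>The case \<open>i = Min S\<close>: the equation at \<open>S - {i}\<close> removes the
  next smallest element, so an increment in another direction enters.\<close>

lemma marginal_Min_rec:
  assumes S: "S \<subseteq> A" "S - {Min S} \<noteq> {}"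
  shows "(2 * p (Min S) + sum p (A - S)) * marginal (Min S) S =
    p (Min (S - {Min S})) * marginal (Min (S - {Min S})) (S - {Min S})
    + (\<Sum>l\<in>A - S. p l * marginal (Min S) (insert l S))"
proof -
  let ?m = "Min S"
  have ne: "S \<noteq> {}" using S by auto
  have m: "?m \<in> S" using Min_mem S ne by blast
  have "S - {?m} \<subseteq> A" using S by auto
  from gen_h[OF this S(2)] gen_h[OF S(1) ne] sum_marginal[OF m] sum_compl_remove[OF S(1) m]
  show ?thesis by (simp add: algebra_simps)
qed

text \<open>At a global minimum \<open>\<mu> < 0\<close> over all pairs, bounding the right side of
  either recursion by \<open>\<mu>\<close> leaves the excess coefficient times \<open>\<mu>\<close>
  nonnegative. That excess is \<open>p i\<close>, or at least \<open>p (Min S)\<close> in the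
  minimum case by \<open>sorted\<close>.\<close>

lemma marginal_nonneg:
  assumes "S \<subseteq> A" "i \<in> S"
  shows "marginal i S \<ge> 0"
proof (rule ccontr)
  assume neg: "\<not> marginal i S \<ge> 0"
  define X where "X = (SIGMA S:Pow A. S)"
  define F where "F = (\<lambda>(S, i). marginal i S)"
  have finX: "finite X"
    unfolding X_def using fin by (intro finite_SigmaI) (auto intro: finite_subset)
  have mem: "(S, i) \<in> X" using assms by (simp add: X_def)
  obtain T j where Tj: "(T, j) \<in> X" and min: "\<And>z. z \<in> X \<Longrightarrow> F (T, j) \<le> F z"
    using arg_min_if_finite(1)[OF finX, of F] arg_min_least[OF finX, of _ F] mem
    by (metis empty_iff prod.exhaust)
  define \<mu> where "\<mu> = marginal j T"
  have T: "T \<subseteq> A" "j \<in> T" using Tj by (auto simp: X_def)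
  have le: "\<mu> \<le> marginal a B" if "B \<subseteq> A" "a \<in> B" for a B
    using min[of "(B, a)"] that by (simp add: X_def F_def \<mu>_def)
  have \<mu>: "\<mu> < 0" using le[OF assms] neg by simp
  have ne: "T \<noteq> {}" using T by auto
  let ?m = "Min T"
  have m: "?m \<in> T" using Min_mem T ne by blast
  have pm: "p ?m > 0" using pos_Min[OF T(1) ne] .
  have "(\<Sum>l\<in>A - T. p l * \<mu>) \<le> (\<Sum>l\<in>A - T. p l * marginal j (insert l T))"
    using T by (intro sum_mono mult_left_mono le) (auto intro: less_imp_le pos)
  hence sum: "sum p (A - T) * \<mu> \<le> (\<Sum>l\<in>A - T. p l * marginal j (insert l T))"
    by (simp add: sum_distrib_right)
  show False
  proof (cases "j = ?m")
    case False
    have "p ?m * \<mu> \<le> p ?m * marginal j (T - {?m})"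
      using pm T False by (intro mult_left_mono le) auto
    hence "(p ?m + p j + sum p (A - T)) * \<mu> \<ge> p ?m * \<mu> + sum p (A - T) * \<mu>"
      using marginal_rec[OF T False] sum by (simp add: \<mu>_def)
    hence "p j * \<mu> \<ge> 0" by (simp add: algebra_simps)
    thus False using \<mu> T pos[of j] by (auto simp: zero_le_mult_iff)
  next
    case j: True
    show False
    proof (cases "T - {?m} = {}")
      case True
      \<comment> \<open>Here \<open>T\<close> is a singleton, which \<open>marginal_Min_rec\<close>
        does not cover.\<close>
      hence "\<mu> = h T"
        using h unfolding \<mu>_def marginal_def j True by (simp add: solution_def)
      thus False using \<mu> solution_nonneg[OF h T(1)] by simp
    next
      case False
      let ?n = "Min (T - {?m})"
      have sub: "T - {?m} \<subseteq> A" using T by auto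
      have n: "?n \<in> T - {?m}" using Min_mem[OF sub False] .
      have "?m \<le> ?n" using n T fin by (intro Min_le) (auto intro: finite_subset)
      hence pn: "p ?n \<le> p ?m" using sorted n m T by blast
      have "p ?n > 0" using pos_Min[OF sub False] .
      hence "p ?n * \<mu> \<le> p ?n * marginal ?n (T - {?m})"
        using n sub by (intro mult_left_mono le) auto
      hence "(2 * p ?m + sum p (A - T)) * \<mu> \<ge> p ?n * \<mu> + sum p (A - T) * \<mu>"
        using marginal_Min_rec[OF T(1) False] sum by (simp add: \<mu>_def flip: j)
      hence "(2 * p ?m - p ?n) * \<mu> \<ge> 0" by (simp add: algebra_simps)
      thus False using \<mu> pm pn by (auto simp: zero_le_mult_iff)
    qed
  qed
qed

text \<open>The same global-minimum argument for the differences \<open>G i j S\<close>, using the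
  recursions multiplied by \<open>p a\<close> and \<open>p b\<close>. It is what later allows one
  removed index to be exchanged for a larger one.\<close>

lemma weighted_marginal_mono:
  assumes "S \<subseteq> A" "i \<in> S" "j \<in> S" "j \<le> i"
  shows "p j * marginal j S \<le> p i * marginal i S"
proof (rule ccontr)
  define X where "X = (SIGMA S:Pow A. {(i, j). i \<in> S \<and> j \<in> S \<and> j \<le> i})"
  define G where "G i j S = p i * marginal i S - p j * marginal j S" for i j S
  define F where "F = (\<lambda>(S, i, j). G i j S)"
  assume neg: "\<not> p j * marginal j S \<le> p i * marginal i S"
  have "X \<subseteq> Pow A \<times> A \<times> A" by (auto simp: X_def)
  hence finX: "finite X" using fin by (meson finite_Pow_iff finite_SigmaI finite_subset)
  have mem: "(S, i, j) \<in> X" using assms by (simp add: X_def)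
  obtain T a b where Tab: "(T, a, b) \<in> X" and min: "\<And>z. z \<in> X \<Longrightarrow> F (T, a, b) \<le> F z"
    using arg_min_if_finite(1)[OF finX, of F] arg_min_least[OF finX, of _ F] mem
    by (metis empty_iff prod.exhaust)
  define \<mu> where "\<mu> = G a b T"
  have T: "T \<subseteq> A" "a \<in> T" "b \<in> T" "b \<le> a" using Tab by (auto simp: X_def)
  have le: "\<mu> \<le> G i j B" if "B \<subseteq> A" "i \<in> B" "j \<in> B" "j \<le> i" for i j B
    using min[of "(B, i, j)"] that by (simp add: X_def F_def \<mu>_def)
  have \<mu>: "\<mu> < 0" using le[OF assms] neg by (simp add: G_def)
  hence ab: "a \<noteq> b" by (auto simp: \<mu>_def G_def)
  have ne: "T \<noteq> {}" using T by auto
  have finT: "finite T" using T fin finite_subset by blast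
  let ?m = "Min T"
  have m: "?m \<in> T" using Min_mem T ne by blast
  have pm: "p ?m > 0" using pos_Min[OF T(1) ne] .
  have am: "a \<noteq> ?m" using T ab finT by (metis Min_le antisym)
  have sub: "T - {?m} \<subseteq> A" using T by auto
  have pab: "p a \<le> p b" "p a > 0" "p b > 0" using sorted T pos by blast+
  have "(\<Sum>l\<in>A - T. p l * \<mu>) \<le> (\<Sum>l\<in>A - T. p l * G a b (insert l T))"
    using T by (intro sum_mono mult_left_mono le) (auto intro: less_imp_le pos)
  hence sum: "sum p (A - T) * \<mu> \<le> p a * (\<Sum>l\<in>A - T. p l * marginal a (insert l T))
      - p b * (\<Sum>l\<in>A - T. p l * marginal b (insert l T))"
    by (simp add: sum_distrib_right sum_distrib_left sum_subtractf G_def algebra_simps)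
  have ra: "p a * ((p ?m + p a + sum p (A - T)) * marginal a T) =
      p a * (p ?m * marginal a (T - {?m}) + (\<Sum>l\<in>A - T. p l * marginal a (insert l T)))"
    using marginal_rec[OF T(1,2) am] by simp
  show False
  proof (cases "b = ?m")
    case False
    have rb: "p b * ((p ?m + p b + sum p (A - T)) * marginal b T) =
        p b * (p ?m * marginal b (T - {?m}) + (\<Sum>l\<in>A - T. p l * marginal b (insert l T)))"
      using marginal_rec[OF T(1,3) False] by simp
    have "p ?m * \<mu> \<le> p ?m * G a b (T - {?m})"
      using pm T am False by (intro mult_left_mono le) auto
    \<comment> \<open>With \<open>x\<close>, \<open>y\<close> the two increments at
      \<open>T\<close>: \<open>p a * p a * x - p b * p b * y = p b * (p a * x - p b * y) + p a * (p
      a - p b) * x\<close>.\<close>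
    with ra rb sum have "p b * \<mu> + p a * ((p a - p b) * marginal a T) \<ge> 0"
      by (simp add: \<mu>_def G_def algebra_simps)
    moreover have "p a * ((p a - p b) * marginal a T) \<le> 0"
      using pab marginal_nonneg[OF T(1,2)]
      by (intro mult_nonneg_nonpos mult_nonpos_nonneg) auto
    moreover have "p b * \<mu> < 0" using \<mu> pab by (simp add: mult_less_0_iff)
    ultimately show False by linarith
  next
    case b: True
    have amem: "a \<in> T - {?m}" using T am by auto
    hence ne': "T - {?m} \<noteq> {}" by blast
    \<comment> \<open>The recursion for \<open>b\<close> brings in the next minimum
      \<open>?n\<close>, and \<open>(a, ?n)\<close> is again an admissible pair on
      \<open>T - {?m}\<close>. The square terms now split as
      \<open>p a * \<mu> + p b * (p a - p b) * marginal b T\<close>.\<close>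
    let ?n = "Min (T - {?m})"
    have n: "?n \<in> T - {?m}" using Min_mem[OF sub ne'] .
    have "?n \<le> a" using amem finT by (intro Min_le) auto
    hence "p ?m * \<mu> \<le> p ?m * G a ?n (T - {?m})"
      using pm amem n sub by (intro mult_left_mono le) auto
    moreover have "p b * ((2 * p b + sum p (A - T)) * marginal b T) =
        p b * (p ?n * marginal ?n (T - {b}) + (\<Sum>l\<in>A - T. p l * marginal b (insert l T)))"
      using marginal_Min_rec[OF T(1) ne'] by (simp flip: b)
    ultimately have "p a * \<mu> + p b * ((p a - p b) * marginal b T) \<ge> 0"
      using ra sum by (simp add: \<mu>_def G_def algebra_simps flip: b)
    moreover have "p b * ((p a - p b) * marginal b T) \<le> 0"
      using pab marginal_nonneg[OF T(1,3)]
      by (intro mult_nonneg_nonpos mult_nonpos_nonneg) auto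
    moreover have "p a * \<mu> < 0" using \<mu> pab by (simp add: mult_less_0_iff)
    ultimately show False by linarith
  qed
qed

end

end

section \<open>Induction on the number of indices\<close>

lemma alpha_Suc: "alpha (Suc n) = 1 + real n * alpha n"
  \<comment> \<open>At \<open>n = 0\<close> the factor \<open>real n\<close> cancels the junk value
    \<open>alpha 0\<close>, so one recursion also yields \<open>alpha 1 = 1\<close>.\<close>
  by (cases n) auto

lemma (in sorted_chain) singleton_bound:
  assumes "solution h" "j \<in> A"
  shows "p j * h {j} \<ge> alpha (card A)"
  using sorted_chain_axioms assms
\<comment> \<open>The smaller index set has its own solution, hence the generalisation over
  \<open>A\<close>, \<open>h\<close> and \<open>j\<close>. The base case is vacuous as
  \<open>j \<in> A\<close>.\<close>
proof (induction "card A" arbitrary: A h j)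
  case (0 A h j)
  interpret C: sorted_chain A p by fact
  show ?case using 0 C.fin by auto
next
  case (Suc n A h j)
  interpret C: sorted_chain A p by fact
  define B where "B = A - {j}"
  interpret B: sorted_chain B p
    using C.fin C.pos C.sorted by unfold_locales (auto simp: B_def)
  have cB: "n = card B" using Suc.hyps Suc.prems C.fin by (simp add: B_def)
  have AB: "A = insert j B" "j \<notin> B" using Suc.prems by (auto simp: B_def)
  obtain g where g: "B.solution g" using B.solution_exists by blast
  define u where "u T = h (insert j T) - h {j}" for T
  have super: "B.gen u T \<ge> 1" if T: "T \<subseteq> B" "T \<noteq> {}" for T
  proof -
    let ?S = "insert j T"
    let ?m = "Min T"
    have S: "?S \<subseteq> A" "?S \<noteq> {}" using T AB by auto
    have m: "?m \<in> T" using B.Min_mem T by blast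
    have finT: "finite T" using T B.fin finite_subset by blast
    have "Min ?S \<le> ?m" using m finT by (intro Min_le) auto
    hence "p (Min ?S) * C.marginal h (Min ?S) ?S \<le> p ?m * C.marginal h ?m ?S"
      using m C.Min_mem[OF S] by (intro C.weighted_marginal_mono Suc.prems S) auto
    hence "1 \<le> p ?m * C.marginal h ?m ?S - (\<Sum>l\<in>A - ?S. p l * (h (insert l ?S) - h ?S))"
      using C.gen_h[OF Suc.prems(2) S] by linarith
    moreover have "?S - {?m} = insert j (T - {?m})" using m T AB by auto
    moreover have "A - ?S = B - T" using AB by auto
    ultimately show ?thesis
      by (simp add: B.gen_def u_def C.marginal_def[OF Suc.prems(2)] insert_commute)
  qed
  have gu: "g {l} \<le> u {l}" if "l \<in> B" for l
    using B.comparison[OF g _ super] that by (simp add: u_def)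
  have "real n * alpha n = (\<Sum>l\<in>B. alpha n)" by (simp add: cB)
  also have "\<dots> \<le> (\<Sum>l\<in>B. p l * g {l})"
    using Suc.hyps(1)[OF cB B.sorted_chain_axioms g] cB by (intro sum_mono) simp
  also have "\<dots> \<le> (\<Sum>l\<in>B. p l * u {l})"
    using gu B.pos by (intro sum_mono mult_left_mono) (auto intro: less_imp_le)
  \<comment> \<open>The equation at \<open>{j}\<close>: removing \<open>j\<close> reaches
    \<open>{}\<close>, and adding \<open>l\<close> gains exactly \<open>u {l}\<close>.\<close>
  also have "\<dots> = p j * h {j} - 1"
  proof -
    have "C.gen h {j} = 1" "h {} = 0" using Suc.prems by (auto simp: C.solution_def)
    thus ?thesis by (simp add: C.gen_def u_def B_def insert_commute)
  qed
  finally show ?case using Suc.hyps(2) by (simp add: alpha_Suc flip: Suc.hyps(2))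
qed

section \<open>Specialisation to the index set {1..k}\<close>

theorem theorem4:
  fixes k :: nat and p :: "nat \<Rightarrow> real"
  assumes "k \<ge> 1"
    and "antimono_on {1..k} p"
    and "\<forall>j\<in>{1..k}. p j > 0"
    and "(\<Sum>j\<in>{1..k}. p j) = 1"
  shows "(\<exists>!h. h \<in> extensional (Pow {1..k}) \<and> solves_system k p h) \<and>
         (\<forall>h. solves_system k p h \<longrightarrow> h {k} \<ge> alpha k / p k)"
proof -
  \<comment> \<open>Keeps the simplifier from turning \<open>{1..k}\<close> into
    \<open>{Suc 0..k}\<close>, which would no longer match the interpretation.\<close>
  note One_nat_def [simp del]
  interpret sorted_chain "{1..k}" p
    using assms by unfold_locales (auto simp: monotone_on_def)
  have solves: "solves_system k p h \<longleftrightarrow> solution h" for h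
    by (simp add: solves_system_def solution_def gen_def diff_eq_eq)
  obtain h0 where h0: "solution h0" using solution_exists by blast
  \<comment> \<open>Uniqueness needs an extensional representative; for
    \<open>S \<subseteq> {1..k}\<close>, \<open>gen\<close> evaluates \<open>h\<close> only at
    subsets of \<open>{1..k}\<close>, so restricting preserves the equations.\<close>
  define h where "h = restrict h0 (Pow {1..k})"
  have "gen h S = gen h0 S" if "S \<subseteq> {1..k}" for S
  proof -
    have "S - {Min S} \<subseteq> {1..k}" using that by blast
    thus ?thesis using that unfolding gen_def h_def
      by (intro arg_cong2[of _ _ _ _ "(-)"] sum.cong) auto
  qed
  hence "solution h" using h0 by (auto simp: solution_def h_def)
  hence "\<exists>!h. h \<in> extensional (Pow {1..k}) \<and> solves_system k p h"
    unfolding solves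
  proof (intro ex1I[of _ h] conjI)
    show "h \<in> extensional (Pow {1..k})" by (simp add: h_def)
    fix g assume g: "g \<in> extensional (Pow {1..k}) \<and> solution g"
    show "g = h"
    proof (rule extensionalityI)
      show "g \<in> extensional (Pow {1..k})" using g by simp
      show "h \<in> extensional (Pow {1..k})" by (simp add: h_def)
      show "g S = h S" if "S \<in> Pow {1..k}" for S
        using g \<open>solution h\<close> that by (intro solution_unique) auto
    qed
  qed
  moreover have "h {k} \<ge> alpha k / p k" if "solves_system k p h" for h
    using singleton_bound[of h k] that assms pos[of k]
    by (simp add: solves pos_divide_le_eq mult.commute)
  ultimately show ?thesis by blast
qed

end
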